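(* For every piecewise expanding skew tent map $f:[0,1]\to[0,1]$ one has $$\sum_{k=0}^\infty\frac1{(f^k)'(1)}=0 .$$
   Context: A skew tent map is a unimodal map $f:[0,1]\to[0,1]$ (continuous, increasing on the left lap $[0,c]$, decreasing on the right lap $[c,1]$, where $c\in(0,1)$ is the turning point) which is affine on each of the two laps and whose core is $[0,1]$, i.e. $f(c)=1$ and $f(1)=0$. Its slope on $[0,c]$ is denoted $s$ and its slope on $[c,1]$ is denoted $-t$; thus $c=(t-1)/t$, and the condition that $f$ maps $[0,1]$ to itself is $\frac1s+\frac1t\ge1$. It is piecewise expanding when $s,t>1$. $f^k$ is the $k$-th iterate, with $f^0$ the identity, so $(f^0)'(1)=1$. The derivative $(f^k)'(1)$ is understood as the one-sided limit $\lim_{x\to1^-}(f^k)'(x)$ (this matters only when $1$ is periodic, in which case the orbit of $1$ may pass through $c$). *)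

theory Defs
  imports "HOL-Analysis.Analysis"
begin

definition unimodal :: "(real \<Rightarrow> real) \<Rightarrow> real \<Rightarrow> bool" where
  "unimodal f c \<longleftrightarrow>
     0 < c \<and> c < 1 \<and>
     f ` {0..1} \<subseteq> {0..1} \<and> continuous_on {0..1} f \<and>
     strict_mono_on {0..c} f \<and> strict_antimono_on {c..1} f"

text \<open>The conditions \<open>f c = 1\<close> and \<open>f 1 = 0\<close> say that the core is \<open>{0..1}\<close>.
  The identity \<open>c = (t - 1) / t\<close> and the inequality \<open>1 / s + 1 / t \<ge> 1\<close> are not
  imposed: they follow from the conditions below.\<close>

definition skew_tent_map :: "(real \<Rightarrow> real) \<Rightarrow> real \<Rightarrow> real \<Rightarrow> real \<Rightarrow> bool" where
  "skew_tent_map f c s t \<longleftrightarrow>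
     unimodal f c \<and>
     (\<exists>a. \<forall>x\<in>{0..c}. f x = a + s * x) \<and>
     (\<exists>b. \<forall>x\<in>{c..1}. f x = b - t * x) \<and>
     f c = 1 \<and> f 1 = 0"

definition expanding_skew_tent_map :: "(real \<Rightarrow> real) \<Rightarrow> bool" where
  "expanding_skew_tent_map f \<longleftrightarrow> (\<exists>c s t. skew_tent_map f c s t \<and> s > 1 \<and> t > 1)"

text \<open>For iterates \<open>g\<close> of a skew tent map, \<open>deriv g\<close> is locally constant on some
  interval to the left of 1, so the limit exists. The values of \<open>g\<close> outside
  \<open>{0..1}\<close> play no role at \<open>x = 1\<close>.\<close>

definition left_deriv :: "(real \<Rightarrow> real) \<Rightarrow> real \<Rightarrow> real" where
  "left_deriv g x = Lim (at_left x) (deriv g)"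

end

theory Submission
  imports Defs
begin

text \<open>On both laps \<open>f x - 1 = d * (x - c)\<close>, where \<open>d\<close> is the slope of the lap, and
  \<open>c = 1 - 1 / t\<close>. Hence, writing \<open>x\<^sub>k\<close> for \<open>(f ^^ k) 1\<close> and \<open>\<lambda>\<^sub>k\<close> for the left derivative
  of \<open>f ^^ k\<close> at 1, \<open>(x\<^sub>k\<^sub>+\<^sub>1 - 1) / \<lambda>\<^sub>k\<^sub>+\<^sub>1 = (x\<^sub>k - 1) / \<lambda>\<^sub>k + 1 / (t * \<lambda>\<^sub>k)\<close>. The series therefore
  telescopes: its \<open>n\<close>-th partial sum is \<open>t * (x\<^sub>n - 1) / \<lambda>\<^sub>n\<close>, which tends to 0 because
  \<open>\<lambda>\<^sub>n\<close> grows exponentially. If \<open>x\<^sub>k = c\<close>, the identity holds for either choice of \<open>d\<close>.\<close>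

text \<open>Every point close enough to \<open>a\<close> on its left has an open neighbourhood on
  which \<open>g\<close> is affine, so \<open>deriv g\<close> is constantly \<open>l\<close> there
  and the limit is trivial.\<close>

lemma left_deriv_eq_if_eventually_affine:
  fixes g :: "real \<Rightarrow> real"
  assumes "\<forall>\<^sub>F x in at_left a. g x = b + l * (x - a)"
  shows "left_deriv g a = l"
proof -
  obtain e where "e < a" and e: "\<And>x. e < x \<Longrightarrow> x < a \<Longrightarrow> g x = b + l * (x - a)"
    using assms unfolding eventually_at_left_field by auto
  have "deriv g x = l" if "e < x" "x < a" for x
  proof (rule DERIV_imp_deriv)
    have "((\<lambda>x. b + l * (x - a)) has_field_derivative l) (at x)"
      by (auto intro!: derivative_eq_intros)
    then show "(g has_field_derivative l) (at x)"
      by (rule has_field_derivative_transform_within_open[where S = "{e<..<a}"])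
        (use that e in auto)
  qed
  then have "\<forall>\<^sub>F x in at_left a. deriv g x = l"
    using \<open>e < a\<close> unfolding eventually_at_left_field by blast
  then have "(deriv g \<longlongrightarrow> l) (at_left a)"
    by (rule tendsto_eventually)
  then show ?thesis
    unfolding left_deriv_def by (intro tendsto_Lim) auto
qed

lemma skew_tent_map_laps:
  assumes "skew_tent_map f c s t"
  shows "0 < c" "c < 1"
    and "\<And>x. x \<in> {0..1} \<Longrightarrow> f x \<in> {0..1}"
    and "\<And>x. x \<in> {0..c} \<Longrightarrow> f x = 1 + s * (x - c)"
    and "\<And>x. x \<in> {c..1} \<Longrightarrow> f x = 1 - t * (x - c)"
    and "t * (1 - c) = 1"
proof -
  show c: "0 < c" "c < 1" and "\<And>x. x \<in> {0..1} \<Longrightarrow> f x \<in> {0..1}"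
    using assms unfolding skew_tent_map_def unimodal_def by blast+
  obtain a b where a: "\<forall>x\<in>{0..c}. f x = a + s * x" and b: "\<forall>x\<in>{c..1}. f x = b - t * x"
    and "f c = 1" and "f 1 = 0"
    using assms unfolding skew_tent_map_def by blast
  \<comment> \<open>Both laps are evaluated at \<open>c\<close>, the right one also at 1. The two
    resulting values of \<open>b\<close> together force \<open>t * (1 - c) = 1\<close>.\<close>
  have ac: "a = 1 - s * c" and bc: "b = 1 + t * c" and bt: "b = t"
    using bspec[OF a, of c] bspec[OF b, of c] bspec[OF b, of 1] c \<open>f c = 1\<close> \<open>f 1 = 0\<close> by auto
  show "f x = 1 + s * (x - c)" if "x \<in> {0..c}" for x
    using bspec[OF a that] by (simp add: ac algebra_simps)
  show "f x = 1 - t * (x - c)" if "x \<in> {c..1}" for x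
    using bspec[OF b that] by (simp add: bc algebra_simps)
  show "t * (1 - c) = 1"
    using bc bt by (simp add: algebra_simps)
qed

lemma skew_tent_map_funpow_in_unit:
  assumes "skew_tent_map f c s t" "x \<in> {0..1}"
  shows "(f ^^ k) x \<in> {0..1}"
  using assms(2) by (induction k) (simp_all add: skew_tent_map_laps(3)[OF assms(1)] del: atLeastAtMost_iff)

text \<open>Used to pick a lap. If \<open>b\<close> differs from \<open>c\<close>, continuity at
  \<open>a\<close> decides the side; if \<open>b = c\<close>, the sign of \<open>l\<close> does. The
  inequalities are not strict, so the limit point \<open>b\<close> falls on the same closed side as
  the nearby values even when the orbit hits the turning point.\<close>

lemma affine_one_sided:
  fixes b c l :: real
  shows "(\<forall>\<^sub>F x in at_left a. b + l * (x - a) \<le> c) \<and> b \<le> c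
       \<or> (\<forall>\<^sub>F x in at_left a. c \<le> b + l * (x - a)) \<and> c \<le> b"
proof -
  have lim: "((\<lambda>x. b + l * (x - a)) \<longlongrightarrow> b) (at_left a)"
    by (auto intro!: tendsto_eq_intros)
  have left: "\<forall>\<^sub>F x in at_left a. x < a"
    by (simp add: eventually_at_filter)
  consider "b < c" | "c < b" | "b = c" "l \<ge> 0" | "b = c" "l \<le> 0"
    by linarith
  then show ?thesis
  proof cases
    case 1
    have "\<forall>\<^sub>F x in at_left a. b + l * (x - a) \<le> c"
      using order_tendstoD(2)[OF lim 1] by (rule eventually_mono) simp
    with 1 show ?thesis by simp
  next
    case 2
    have "\<forall>\<^sub>F x in at_left a. c \<le> b + l * (x - a)"
      using order_tendstoD(1)[OF lim 2] by (rule eventually_mono) simp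
    with 2 show ?thesis by simp
  next
    case 3
    have "\<forall>\<^sub>F x in at_left a. b + l * (x - a) \<le> c"
      using left by (rule eventually_mono) (use 3 in \<open>simp add: mult_nonneg_nonpos\<close>)
    with 3 show ?thesis by simp
  next
    case 4
    have "\<forall>\<^sub>F x in at_left a. c \<le> b + l * (x - a)"
      using left by (rule eventually_mono) (use 4 in \<open>simp add: mult_nonpos_nonpos\<close>)
    with 4 show ?thesis by simp
  qed
qed

text \<open>Near \<open>a\<close> on the left, \<open>g\<close> stays in one closed lap that also
  contains \<open>g a\<close>, so a single affine formula for \<open>f\<close> serves both. Its
  slope \<open>d\<close> is the factor of the chain rule; if \<open>g a = c\<close>, the side from
  which \<open>g\<close> approaches \<open>c\<close> selects it.\<close>

lemma skew_tent_map_eventually_affine_compose: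
  assumes f: "skew_tent_map f c s t"
    and g: "\<forall>\<^sub>F x in at_left a. g x = g a + l * (x - a)"
    and g_unit: "\<forall>\<^sub>F x in at_left a. g x \<in> {0..1}" "g a \<in> {0..1}"
  obtains d where "d = s \<or> d = - t" "f (g a) = 1 + d * (g a - c)"
    "\<forall>\<^sub>F x in at_left a. f (g x) = f (g a) + d * l * (x - a)"
proof -
  note laps = skew_tent_map_laps[OF f]
  from affine_one_sided[where a = a and b = "g a" and l = l and c = c] show thesis
  proof
    assume *: "(\<forall>\<^sub>F x in at_left a. g a + l * (x - a) \<le> c) \<and> g a \<le> c"
    then have fa: "f (g a) = 1 + s * (g a - c)"
      using g_unit(2) by (intro laps(4)) auto
    from conjunct1[OF *] g g_unit(1)
    have "\<forall>\<^sub>F x in at_left a. f (g x) = f (g a) + s * l * (x - a)"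
    proof eventually_elim
      case (elim x)
      then have "f (g x) = 1 + s * (g x - c)"
        by (intro laps(4)) auto
      also have "\<dots> = f (g a) + s * (g x - g a)"
        by (simp add: fa algebra_simps)
      also have "g x - g a = l * (x - a)"
        using elim by simp
      finally show ?case by simp
    qed
    with that[of s] fa show thesis by simp
  next
    assume *: "(\<forall>\<^sub>F x in at_left a. c \<le> g a + l * (x - a)) \<and> c \<le> g a"
    then have fa: "f (g a) = 1 - t * (g a - c)"
      using g_unit(2) by (intro laps(5)) auto
    from conjunct1[OF *] g g_unit(1)
    have "\<forall>\<^sub>F x in at_left a. f (g x) = f (g a) + (- t) * l * (x - a)"
    proof eventually_elim
      case (elim x)
      then have "f (g x) = 1 - t * (g x - c)"
        by (intro laps(5)) auto
      also have "\<dots> = f (g a) - t * (g x - g a)"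
        by (simp add: fa algebra_simps)
      also have "g x - g a = l * (x - a)"
        using elim by simp
      finally show ?case by simp
    qed
    with that[of "- t"] fa show thesis by simp
  qed
qed

text \<open>Induction on \<open>n\<close>. The affine form identifies \<open>l\<close> as the left
  derivative of \<open>f ^^ n\<close> at 1; the lower bound keeps \<open>l\<close> nonzero and later
  gives the decay.\<close>

lemma skew_tent_map_partial_sum:
  assumes f: "skew_tent_map f c s t" and st: "s > 1" "t > 1"
  obtains l where "\<forall>\<^sub>F x in at_left 1. (f ^^ n) x = (f ^^ n) 1 + l * (x - 1)"
    "min s t ^ n \<le> \<bar>l\<bar>"
    "(\<Sum>k<n. 1 / left_deriv (f ^^ k) 1) = t * ((f ^^ n) 1 - 1) / l"
proof -
  have "\<exists>l. (\<forall>\<^sub>F x in at_left 1. (f ^^ n) x = (f ^^ n) 1 + l * (x - 1)) \<and> min s t ^ n \<le> \<bar>l\<bar>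
    \<and> (\<Sum>k<n. 1 / left_deriv (f ^^ k) 1) = t * ((f ^^ n) 1 - 1) / l"
  proof (induction n)
    case 0
    \<comment> \<open>The identity has slope 1, and the closed form vanishes like the empty sum
      because the orbit starts at 1.\<close>
    show ?case by (intro exI[of _ 1]) auto
  next
    case (Suc n)
    let ?x = "(f ^^ n) 1"
    from Suc obtain l where l: "\<forall>\<^sub>F x in at_left 1. (f ^^ n) x = ?x + l * (x - 1)"
      and l_ge: "min s t ^ n \<le> \<bar>l\<bar>"
      and sum: "(\<Sum>k<n. 1 / left_deriv (f ^^ k) 1) = t * (?x - 1) / l"
      by blast
    have "\<forall>\<^sub>F x in at_left (1::real). x \<in> {0..1}"
      unfolding eventually_at_left_field by (auto intro!: exI[of _ 0])
    then have unit: "\<forall>\<^sub>F x in at_left 1. (f ^^ n) x \<in> {0..1}"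
      by (rule eventually_mono) (rule skew_tent_map_funpow_in_unit[OF f])
    obtain d where d: "d = s \<or> d = - t" and fx: "f ?x = 1 + d * (?x - c)"
      and dl: "\<forall>\<^sub>F x in at_left 1. f ((f ^^ n) x) = f ?x + d * l * (x - 1)"
      using skew_tent_map_eventually_affine_compose[OF f l unit]
        skew_tent_map_funpow_in_unit[OF f, of 1 n] by auto
    have "min s t ^ n > 0"
      using st by simp
    with l_ge have "l \<noteq> 0"
      by auto
    have "d \<noteq> 0" "min s t \<le> \<bar>d\<bar>"
      using d st by auto
    then have "min s t ^ Suc n \<le> \<bar>d * l\<bar>"
      using l_ge st by (simp add: abs_mult mult_mono)
    moreover have "(\<Sum>k<Suc n. 1 / left_deriv (f ^^ k) 1) = t * (f ?x - 1) / (d * l)"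
    proof -
      \<comment> \<open>The new term \<open>1 / l\<close> is rewritten with
        \<open>t * (1 - c) = 1\<close>; adding it replaces \<open>?x - 1\<close> by
        \<open>?x - c\<close>, and \<open>d * (?x - c) = f ?x - 1\<close>.\<close>
      have "(\<Sum>k<Suc n. 1 / left_deriv (f ^^ k) 1) = t * (?x - 1) / l + t * (1 - c) / l"
        using sum left_deriv_eq_if_eventually_affine[OF l] skew_tent_map_laps(6)[OF f] by simp
      also have "\<dots> = t * (?x - c) / l"
        by (simp add: add_divide_distrib[symmetric] algebra_simps)
      also have "\<dots> = t * (f ?x - 1) / (d * l)"
        using \<open>d \<noteq> 0\<close> by (simp add: fx)
      finally show ?thesis .
    qed
    ultimately show ?case
      using dl by (intro exI[of _ "d * l"]) simp
  qed
  with that show thesis by blast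
qed

theorem mainTheorem3:
  fixes f :: "real \<Rightarrow> real"
  assumes "expanding_skew_tent_map f"
  shows "(\<lambda>k. 1 / left_deriv (f ^^ k) 1) sums 0"
proof -
  obtain c s t where f: "skew_tent_map f c s t" and st: "s > 1" "t > 1"
    using assms unfolding expanding_skew_tent_map_def by blast
  define m where "m = min s t"
  have m: "m > 1"
    using st by (simp add: m_def)
  have "norm (\<Sum>k<n. 1 / left_deriv (f ^^ k) 1) \<le> t * (1 / m) ^ n" for n
  proof -
    obtain l where l: "m ^ n \<le> \<bar>l\<bar>"
      and sum: "(\<Sum>k<n. 1 / left_deriv (f ^^ k) 1) = t * ((f ^^ n) 1 - 1) / l"
      using skew_tent_map_partial_sum[OF f st] unfolding m_def by blast
    \<comment> \<open>The orbit of 1 stays in the unit interval, so the numerator is at most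
      \<open>t\<close> in absolute value and the growth of \<open>l\<close> alone forces
      convergence.\<close>
    have "\<bar>(f ^^ n) 1 - 1\<bar> \<le> 1"
      using skew_tent_map_funpow_in_unit[OF f, of 1 n] by auto
    then have "t * \<bar>(f ^^ n) 1 - 1\<bar> / \<bar>l\<bar> \<le> t * 1 / m ^ n"
      using l m st by (intro frac_le mult_left_mono) auto
    then show ?thesis
      using st by (simp add: sum abs_mult power_one_over)
  qed
  moreover have "(\<lambda>n. t * (1 / m) ^ n) \<longlonglongrightarrow> 0"
    using m by (auto intro!: tendsto_mult_right_zero LIMSEQ_realpow_zero)
  ultimately show ?thesis
    unfolding sums_def by (rule Lim_null_comparison[OF always_eventually[OF allI]])
qed

end
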